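(* Let $k$ be a positive integer and let $G$ be an $n$-vertex graph with largest Laplacian eigenvalue $\mu>0$. For any nonempty $k$-independent set $S$ of $G$, $$|S|\leq\frac{n(\mu^k-d_k(S))}{\mu^k}.$$
   Context: Graphs are finite, simple, undirected. The Laplacian matrix of $G$ is $L=D-A$, where $D$ is the diagonal matrix of vertex degrees and $A$ is the adjacency matrix of $G$; the eigenvalues of $L$ are the Laplacian eigenvalues of $G$. For a nonempty vertex subset $S$, $d_k(S)=|S|^{-1}\sum_{u\in S}(L^k)_{uu}$. A $k$-independent set of $G$ is a set of vertices any two distinct members of which are at distance greater than $k$ in $G$ (vertices in different components are at infinite distance). *)

theory Defs
  imports
    "Graph_Theory.Digraph"
    "Graph_Theory.Shortest_Path"
    "Jordan_Normal_Form.Char_Poly"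
begin

text \<open>
  A finite simple undirected graph is a symmetric loop-free digraph without parallel arcs
  (locale \<^locale>\<open>graph\<close>): every edge is a pair of opposite arcs, so the degree of a vertex is
  its out-degree. Matrices are indexed by natural numbers, so they are taken with respect to an
  enumeration \<open>vs\<close> of the vertices.
\<close>

definition enumerates_verts :: "('a, 'b) pre_digraph \<Rightarrow> 'a list \<Rightarrow> bool" where
  "enumerates_verts G vs \<longleftrightarrow> distinct vs \<and> set vs = verts G"

definition degree_mat :: "('a, 'b) pre_digraph \<Rightarrow> 'a list \<Rightarrow> real mat" where
  "degree_mat G vs = mat (length vs) (length vs)
     (\<lambda>(i, j). if i = j then real (out_degree G (vs ! i)) else 0)"

definition adjacency_mat :: "('a, 'b) pre_digraph \<Rightarrow> 'a list \<Rightarrow> real mat" where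
  "adjacency_mat G vs = mat (length vs) (length vs)
     (\<lambda>(i, j). if vs ! i \<rightarrow>\<^bsub>G\<^esub> vs ! j then 1 else 0)"

definition laplacian_mat :: "('a, 'b) pre_digraph \<Rightarrow> 'a list \<Rightarrow> real mat" where
  "laplacian_mat G vs = degree_mat G vs - adjacency_mat G vs"

text \<open>
  Only real eigenvalues are considered; for symmetric matrices such as the Laplacian these are
  all of them.
\<close>

definition largest_eigenvalue :: "real mat \<Rightarrow> real \<Rightarrow> bool" where
  "largest_eigenvalue A \<mu> \<longleftrightarrow> eigenvalue A \<mu> \<and> (\<forall>x. eigenvalue A x \<longrightarrow> x \<le> \<mu>)"

definition avg_diag_laplacian_pow :: "('a, 'b) pre_digraph \<Rightarrow> 'a list \<Rightarrow> nat \<Rightarrow> 'a set \<Rightarrow> real" where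
  "avg_diag_laplacian_pow G vs k S =
     (\<Sum>i | i < length vs \<and> vs ! i \<in> S. (laplacian_mat G vs ^\<^sub>m k) $$ (i, i)) / real (card S)"

text \<open>
  The distance is the minimum cost of a walk when every arc has cost 1; it is
  \<open>\<infinity>\<close> when there is no walk.
\<close>

definition graph_dist :: "('a, 'b) pre_digraph \<Rightarrow> 'a \<Rightarrow> 'a \<Rightarrow> ereal" where
  "graph_dist G u v = wf_digraph.\<mu> G (\<lambda>_. 1) u v"

definition k_independent :: "('a, 'b) pre_digraph \<Rightarrow> nat \<Rightarrow> 'a set \<Rightarrow> bool" where
  "k_independent G k S \<longleftrightarrow> S \<subseteq> verts G \<and>
     (\<forall>u\<in>S. \<forall>v\<in>S. u \<noteq> v \<longrightarrow> graph_dist G u v > ereal (real k))"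

end

theory Submission
  imports Defs "HOL-Analysis.Function_Topology"
begin

text \<open>
  Let \<open>x\<close> be the indicator vector of \<open>S\<close> and \<open>y\<close> its projection orthogonal to the all-ones
  vector, so that \<open>y \<bullet> y = s - s\<^sup>2 / n\<close> for \<open>s = card S\<close>. Off-diagonal entries of \<open>L\<^sup>k\<close> vanish
  between vertices at distance more than \<open>k\<close>, and \<open>L\<close> annihilates the all-ones vector, hence
  \<open>y \<bullet> L\<^sup>k y = x \<bullet> L\<^sup>k x = s d\<^sub>k(S)\<close>. The bound is then \<open>y \<bullet> L\<^sup>k y \<le> \<mu>\<^sup>k (y \<bullet> y)\<close>. This is obtained
  without diagonalising \<open>L\<close>: the maximum of \<open>x \<bullet> L x\<close> on the unit sphere is an eigenvalue, and
  Cauchy-Schwarz for the semidefinite form \<open>x \<bullet> L y\<close> turns \<open>x \<bullet> L x \<le> \<mu> (x \<bullet> x)\<close> into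
  \<open>L x \<bullet> L x \<le> \<mu>\<^sup>2 (x \<bullet> x)\<close>, which iterates.
\<close>

section \<open>Quadratic forms of real symmetric matrices\<close>

lemma real_scalar_prod_self_nonneg: "(x :: real vec) \<bullet> x \<ge> 0"
  unfolding scalar_prod_def by (intro sum_nonneg) auto

lemma real_scalar_prod_self_eq_0:
  assumes "x \<in> carrier_vec n" "(x :: real vec) \<bullet> x = 0"
  shows "x = 0\<^sub>v n"
proof -
  have "\<forall>i\<in>{0..<dim_vec x}. x $ i * x $ i = 0"
    using assms(2) unfolding scalar_prod_def
    by (subst (asm) sum_nonneg_eq_0_iff) auto
  with assms(1) show ?thesis by (intro eq_vecI) auto
qed

lemma symmetric_mat_scalar_prod:
  fixes A :: "real mat"
  assumes "A \<in> carrier_mat n n" "transpose_mat A = A" "x \<in> carrier_vec n" "y \<in> carrier_vec n"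
  shows "x \<bullet> (A *\<^sub>v y) = y \<bullet> (A *\<^sub>v x)"
proof -
  have "x \<bullet> (A *\<^sub>v y) = (A *\<^sub>v x) \<bullet> y"
    using transpose_vec_mult_scalar[of A n n y x] assms by simp
  also have "\<dots> = y \<bullet> (A *\<^sub>v x)"
    using assms by (intro comm_scalar_prod[of _ n]) auto
  finally show ?thesis .
qed

lemma mat_vec_diff_smult:
  fixes A :: "real mat"
  assumes "A \<in> carrier_mat n n" "x \<in> carrier_vec n"
  shows "(m \<cdot>\<^sub>m 1\<^sub>m n - A) *\<^sub>v x = m \<cdot>\<^sub>v x - A *\<^sub>v x"
proof -
  have "(m \<cdot>\<^sub>m 1\<^sub>m n) *\<^sub>v x = m \<cdot>\<^sub>v x"
    using assms by (intro eq_vecI) (auto simp: row_smult)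
  then show ?thesis using assms by (simp add: minus_mult_distrib_mat_vec[of _ n n])
qed

lemma quadratic_form_add_smult:
  fixes A :: "real mat"
  assumes A: "A \<in> carrier_mat n n" "transpose_mat A = A"
    and x: "x \<in> carrier_vec n" and y: "y \<in> carrier_vec n"
  shows "(s \<cdot>\<^sub>v x + t \<cdot>\<^sub>v y) \<bullet> (A *\<^sub>v (s \<cdot>\<^sub>v x + t \<cdot>\<^sub>v y)) =
    s\<^sup>2 * (x \<bullet> (A *\<^sub>v x)) + 2 * s * t * (x \<bullet> (A *\<^sub>v y)) + t\<^sup>2 * (y \<bullet> (A *\<^sub>v y))"
proof -
  have Ax: "A *\<^sub>v x \<in> carrier_vec n" and Ay: "A *\<^sub>v y \<in> carrier_vec n"
    using A x y by (auto intro: mult_mat_vec_carrier)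
  have "A *\<^sub>v (s \<cdot>\<^sub>v x + t \<cdot>\<^sub>v y) = s \<cdot>\<^sub>v (A *\<^sub>v x) + t \<cdot>\<^sub>v (A *\<^sub>v y)"
    using A x y by (simp add: mult_add_distrib_mat_vec[of _ n n] mult_mat_vec[of _ n n])
  then show ?thesis
    using x y Ax Ay symmetric_mat_scalar_prod[OF A y x]
    by (simp add: add_scalar_prod_distrib[of _ n] scalar_prod_add_distrib[of _ n]
        algebra_simps power2_eq_square)
qed

text \<open>Only pairs with both indices in \<open>Q\<close> contribute to the double sum, and
  \<open>off\<close> removes the unequal ones. With \<open>A\<close> a power of the Laplacian this
  is where independence of the set enters.\<close>

lemma indicator_quadratic_form:
  fixes A :: "real mat"
  assumes A: "A \<in> carrier_mat n n"
    and off: "\<And>i j. i < n \<Longrightarrow> j < n \<Longrightarrow> Q i \<Longrightarrow> Q j \<Longrightarrow> i \<noteq> j \<Longrightarrow> A $$ (i, j) = 0"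
  shows "vec n (\<lambda>i. if Q i then 1 else 0) \<bullet> (A *\<^sub>v vec n (\<lambda>i. if Q i then 1 else 0)) =
    (\<Sum>i | i < n \<and> Q i. A $$ (i, i))"
proof -
  let ?x = "\<lambda>i. if Q i then 1 else 0 :: real"
  have "vec n ?x \<bullet> (A *\<^sub>v vec n ?x) = (\<Sum>i<n. ?x i * (\<Sum>j<n. A $$ (i, j) * ?x j))"
    using A by (simp add: scalar_prod_def lessThan_atLeast0)
  also have "\<dots> = (\<Sum>i<n. if Q i then A $$ (i, i) else 0)"
  proof (intro sum.cong refl)
    fix i assume "i \<in> {..<n}"
    then have i: "i < n" by simp
    have "(\<Sum>j<n. A $$ (i, j) * ?x j) = (\<Sum>j<n. if j = i then A $$ (i, i) else 0)" if "Q i"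
      using off i that by (intro sum.cong) auto
    then show "?x i * (\<Sum>j<n. A $$ (i, j) * ?x j) = (if Q i then A $$ (i, i) else 0)"
      using i by simp
  qed
  also have "\<dots> = (\<Sum>i | i < n \<and> Q i. A $$ (i, i))"
    by (simp add: sum.If_cases Int_def)
  finally show ?thesis .
qed

section \<open>Semidefinite forms and the Cauchy-Schwarz inequality\<close>

text \<open>Symmetry is included because nonnegativity of a real quadratic form does not force it,
  while the expansion of the form on a linear combination relies on it.\<close>

definition psd_mat :: "nat \<Rightarrow> real mat \<Rightarrow> bool" where
  "psd_mat n A \<longleftrightarrow> A \<in> carrier_mat n n \<and> transpose_mat A = A \<and>
     (\<forall>x\<in>carrier_vec n. x \<bullet> (A *\<^sub>v x) \<ge> 0)"

text \<open>Makes the Cauchy-Schwarz inequality for the ordinary scalar product a special case of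
  the next lemma.\<close>

lemma psd_mat_one: "psd_mat n (1\<^sub>m n)"
  by (auto simp: psd_mat_def real_scalar_prod_self_nonneg)

text \<open>Discriminant argument: the form is nonnegative on every combination of \<open>x\<close>
  and \<open>y\<close>, and two well-chosen combinations suffice.\<close>

lemma psd_mat_Cauchy_Schwarz:
  assumes A: "psd_mat n A" and x: "x \<in> carrier_vec n" and y: "y \<in> carrier_vec n"
  shows "(x \<bullet> (A *\<^sub>v y))\<^sup>2 \<le> (x \<bullet> (A *\<^sub>v x)) * (y \<bullet> (A *\<^sub>v y))"
proof -
  define a b c where "a = x \<bullet> (A *\<^sub>v x)" and "b = x \<bullet> (A *\<^sub>v y)" and "c = y \<bullet> (A *\<^sub>v y)"
  have Q: "s\<^sup>2 * a + 2 * s * t * b + t\<^sup>2 * c \<ge> 0" for s t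
    using A x y quadratic_form_add_smult[of A n x y s t]
    unfolding psd_mat_def a_def b_def c_def
    by (metis add_carrier_vec smult_carrier_vec)
  have nonneg: "a \<ge> 0" "c \<ge> 0"
    using A x y unfolding psd_mat_def a_def c_def by auto
  have "b\<^sup>2 \<le> a * c"
  proof (cases "c = 0")
    case True
    \<comment> \<open>With \<open>c = 0\<close> the form is linear in \<open>t\<close>; at
      \<open>s = b\<close>, \<open>t = - (a + 1)\<close> it equals
      \<open>- b\<^sup>2 * (a + 2)\<close>, which forces \<open>b = 0\<close>.\<close>
    have "b\<^sup>2 * (a + 2) \<le> 0"
      using Q[of b "- (a + 1)"] True by (simp add: algebra_simps power2_eq_square)
    then show ?thesis
      using nonneg True by (simp add: mult_le_0_iff)
  next
    case False
    \<comment> \<open>The coefficients \<open>c\<close> and \<open>- b\<close> give, up to scaling,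
      the minimiser of the form along \<open>x + t y\<close>.\<close>
    have "0 \<le> c * (a * c - b\<^sup>2)"
      using Q[of c "- b"] by (simp add: algebra_simps power2_eq_square)
    then show ?thesis
      using nonneg False by (simp add: zero_le_mult_iff)
  qed
  then show ?thesis by (simp add: a_def b_def c_def)
qed

text \<open>Cauchy-Schwarz applied to the pair \<open>A x\<close>, \<open>x\<close> bounds the
  squared norm of \<open>A x\<close> by a multiple of \<open>x \<bullet> A x\<close>.\<close>

lemma psd_mat_isotropic_kernel:
  assumes A: "psd_mat n A" and x: "x \<in> carrier_vec n" and "x \<bullet> (A *\<^sub>v x) = 0"
  shows "A *\<^sub>v x = 0\<^sub>v n"
proof -
  have Ax: "A *\<^sub>v x \<in> carrier_vec n"
    using A x by (auto simp: psd_mat_def intro: mult_mat_vec_carrier)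
  have "((A *\<^sub>v x) \<bullet> (A *\<^sub>v x))\<^sup>2 \<le> 0"
    using psd_mat_Cauchy_Schwarz[OF A Ax x] assms(3) by simp
  then have "(A *\<^sub>v x) \<bullet> (A *\<^sub>v x) = 0"
    by simp
  then show ?thesis by (rule real_scalar_prod_self_eq_0[OF Ax])
qed

section \<open>The largest eigenvalue as a maximum of the quadratic form\<close>

text \<open>
  Vectors of varying dimension carry no topology; the unit sphere is handled as a closed subset
  of the compact product of intervals inside \<open>nat \<Rightarrow> real\<close>.
\<close>

lemma quadratic_form_attains_max:
  fixes A :: "real mat"
  assumes A: "A \<in> carrier_mat n n" and n: "n > 0"
  obtains v where "v \<in> carrier_vec n" "v \<bullet> v = 1"
    "\<And>x. x \<in> carrier_vec n \<Longrightarrow> x \<bullet> x = 1 \<Longrightarrow> x \<bullet> (A *\<^sub>v x) \<le> v \<bullet> (A *\<^sub>v v)"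
proof -
  \<comment> \<open>Coordinates from \<open>n\<close> on are pinned to 0: every factor is compact,
    and a point of \<open>K\<close> is determined by its first \<open>n\<close> entries.\<close>
  define K where "K = (\<Pi>\<^sub>E i\<in>UNIV. if i < n then {- 1..1 :: real} else {0})"
  define N where "N f = (\<Sum>i<n. f i * f i)" for f :: "nat \<Rightarrow> real"
  define q where "q f = (\<Sum>i<n. f i * (\<Sum>j<n. A $$ (i, j) * f j))" for f :: "nat \<Rightarrow> real"
  have "compactin (product_topology (\<lambda>i. euclidean) UNIV) K"
    unfolding K_def compactin_PiE by auto
  then have "compact K"
    by (simp add: euclidean_product_topology)
  have "continuous_on UNIV N"
    unfolding N_def by (intro continuous_intros) auto
  then have "closed (N -` {1})"
    by (intro closed_vimage) auto
  with \<open>compact K\<close> have cpt: "compact (K \<inter> N -` {1})"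
    by (rule compact_Int_closed)
  have "(\<lambda>i. if i = 0 then 1 else 0) \<in> K \<inter> N -` {1}"
    using n by (auto simp: K_def N_def if_distrib cong: if_cong)
  then have ne: "K \<inter> N -` {1} \<noteq> {}" by blast
  have "continuous_on UNIV q"
    unfolding q_def by (intro continuous_intros) auto
  then have "continuous_on (K \<inter> N -` {1}) q"
    by (rule continuous_on_subset) auto
  from continuous_attains_sup[OF cpt ne this] obtain f where
    f: "f \<in> K" "N f = 1" and max: "\<And>g. g \<in> K \<Longrightarrow> N g = 1 \<Longrightarrow> q g \<le> q f"
    by auto
  have N_vec: "vec n g \<bullet> vec n g = N g" for g
    by (simp add: scalar_prod_def N_def lessThan_atLeast0)
  have q_vec: "vec n g \<bullet> (A *\<^sub>v vec n g) = q g" for g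
    using A by (simp add: scalar_prod_def q_def lessThan_atLeast0)
  show ?thesis
  proof
    show "vec n f \<in> carrier_vec n" by simp
    show "vec n f \<bullet> vec n f = 1" using f N_vec by simp
  next
    fix x :: "real vec" assume x: "x \<in> carrier_vec n" "x \<bullet> x = 1"
    define g where "g i = (if i < n then x $ i else 0)" for i
    have xg: "x = vec n g"
      using x(1) by (intro eq_vecI) (auto simp: g_def)
    have "N g = 1" using x(2) N_vec[of g] xg by simp
    \<comment> \<open>A coordinate of a unit vector lies in \<open>[-1, 1]\<close>, so the box
      contains the whole sphere.\<close>
    moreover have "g i \<in> {- 1..1}" if "i < n" for i
    proof -
      have "g i * g i \<le> N g"
        unfolding N_def using that by (intro member_le_sum) auto
      then have "(g i)\<^sup>2 \<le> 1"
        using \<open>N g = 1\<close> by (simp add: power2_eq_square)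
      then show ?thesis
        by (simp add: abs_square_le_1 abs_le_iff)
    qed
    then have "g \<in> K"
      by (auto simp: K_def g_def)
    ultimately show "x \<bullet> (A *\<^sub>v x) \<le> vec n f \<bullet> (A *\<^sub>v vec n f)"
      using max[of g] q_vec[of f] q_vec[of g] xg by simp
  qed
qed

text \<open>For the maximum \<open>m\<close> of the form on the unit sphere, the matrix
  \<open>m I - A\<close> is semidefinite and the maximiser \<open>v\<close> is isotropic for it.
  Hence \<open>v\<close> lies in its kernel, that is, \<open>A v = m v\<close>.\<close>

lemma quadratic_form_le_eigenvalue:
  fixes A :: "real mat"
  assumes A: "A \<in> carrier_mat n n" "transpose_mat A = A" and n: "n > 0"
  obtains m where "eigenvalue A m" "\<And>x. x \<in> carrier_vec n \<Longrightarrow> x \<bullet> (A *\<^sub>v x) \<le> m * (x \<bullet> x)"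
proof -
  obtain v where v: "v \<in> carrier_vec n" "v \<bullet> v = 1" and
    max: "\<And>x. x \<in> carrier_vec n \<Longrightarrow> x \<bullet> x = 1 \<Longrightarrow> x \<bullet> (A *\<^sub>v x) \<le> v \<bullet> (A *\<^sub>v v)"
    using quadratic_form_attains_max[OF A(1) n] by metis
  define m where "m = v \<bullet> (A *\<^sub>v v)"
  have le: "x \<bullet> (A *\<^sub>v x) \<le> m * (x \<bullet> x)" if x: "x \<in> carrier_vec n" for x
  proof (cases "x \<bullet> x = 0")
    case True
    then have "x = 0\<^sub>v n" by (rule real_scalar_prod_self_eq_0[OF x])
    then show ?thesis using A by simp
  next
    case False
    then have pos: "x \<bullet> x > 0"
      using real_scalar_prod_self_nonneg[of x] by linarith
    define r where "r = 1 / sqrt (x \<bullet> x)"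
    have rr: "r * r = 1 / (x \<bullet> x)"
      using pos by (simp add: r_def)
    have rx: "r \<cdot>\<^sub>v x \<in> carrier_vec n" using x by simp
    have "(r \<cdot>\<^sub>v x) \<bullet> (r \<cdot>\<^sub>v x) = r * r * (x \<bullet> x)"
      by simp
    then have "(r \<cdot>\<^sub>v x) \<bullet> (r \<cdot>\<^sub>v x) = 1"
      using rr pos by simp
    from max[OF rx this] have "(r \<cdot>\<^sub>v x) \<bullet> (A *\<^sub>v (r \<cdot>\<^sub>v x)) \<le> m"
      by (simp add: m_def)
    moreover have "(r \<cdot>\<^sub>v x) \<bullet> (A *\<^sub>v (r \<cdot>\<^sub>v x)) = r * r * (x \<bullet> (A *\<^sub>v x))"
      using A x by (simp add: mult_mat_vec[of _ n n])
    ultimately show ?thesis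
      using rr pos by (simp add: field_simps)
  qed
  let ?B = "m \<cdot>\<^sub>m 1\<^sub>m n - A"
  have form: "x \<bullet> (?B *\<^sub>v x) = m * (x \<bullet> x) - x \<bullet> (A *\<^sub>v x)" if "x \<in> carrier_vec n" for x
    using that A by (simp add: mat_vec_diff_smult scalar_prod_minus_distrib[of _ n])
  have "transpose_mat (m \<cdot>\<^sub>m 1\<^sub>m n) = m \<cdot>\<^sub>m 1\<^sub>m n"
    by (intro eq_matI) auto
  then have "transpose_mat ?B = ?B"
    using A by (simp add: transpose_minus[of _ n n])
  then have "psd_mat n ?B"
    using A form le by (auto simp: psd_mat_def)
  moreover have "v \<bullet> (?B *\<^sub>v v) = 0"
    using form[OF v(1)] v by (simp add: m_def)
  ultimately have "?B *\<^sub>v v = 0\<^sub>v n"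
    using psd_mat_isotropic_kernel v(1) by blast
  then have 0: "m \<cdot>\<^sub>v v - A *\<^sub>v v = 0\<^sub>v n"
    using A v by (simp add: mat_vec_diff_smult)
  have "A *\<^sub>v v = m \<cdot>\<^sub>v v"
  proof (rule eq_vecI)
    fix i assume "i < dim_vec (m \<cdot>\<^sub>v v)"
    then have "i < n" using v by simp
    then have "(m \<cdot>\<^sub>v v - A *\<^sub>v v) $ i = 0" by (simp add: 0)
    then show "(A *\<^sub>v v) $ i = (m \<cdot>\<^sub>v v) $ i"
      using \<open>i < n\<close> A v by simp
  qed (use A v in auto)
  moreover have "v \<noteq> 0\<^sub>v n"
    using v by auto
  ultimately have "eigenvalue A m"
    using A v unfolding eigenvalue_def eigenvector_def by auto
  then show ?thesis using le by (rule that)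
qed

lemma largest_eigenvalue_quadratic_form_le:
  assumes A: "A \<in> carrier_mat n n" "transpose_mat A = A"
    and "largest_eigenvalue A \<mu>" and x: "x \<in> carrier_vec n"
  shows "x \<bullet> (A *\<^sub>v x) \<le> \<mu> * (x \<bullet> x)"
proof -
  \<comment> \<open>The unit sphere is nonempty only in positive dimension; the existence of an
    eigenvalue guarantees this.\<close>
  have "n > 0"
    using eigenvalue_imp_nonzero_dim[OF A(1)] assms(3) by (auto simp: largest_eigenvalue_def)
  then obtain m where m: "eigenvalue A m" "x \<bullet> (A *\<^sub>v x) \<le> m * (x \<bullet> x)"
    using quadratic_form_le_eigenvalue[OF A] x by metis
  then have "m * (x \<bullet> x) \<le> \<mu> * (x \<bullet> x)"
    using assms(3) real_scalar_prod_self_nonneg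
    by (intro mult_right_mono) (auto simp: largest_eigenvalue_def)
  with m show ?thesis by linarith
qed

section \<open>Bounds for powers of a semidefinite matrix\<close>

text \<open>With \<open>z = A x\<close>, Cauchy-Schwarz bounds the square of
  \<open>z \<bullet> z = z \<bullet> A x\<close> by
  \<open>(z \<bullet> A z) (x \<bullet> A x)\<close>; both factors are bounded by \<open>le\<close>,
  and one factor \<open>z \<bullet> z\<close> cancels.\<close>

lemma psd_mat_norm_le:
  assumes A: "psd_mat n A"
    and le: "\<And>x. x \<in> carrier_vec n \<Longrightarrow> x \<bullet> (A *\<^sub>v x) \<le> \<mu> * (x \<bullet> x)"
    and x: "x \<in> carrier_vec n"
  shows "(A *\<^sub>v x) \<bullet> (A *\<^sub>v x) \<le> \<mu>\<^sup>2 * (x \<bullet> x)"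
proof -
  define z where "z = A *\<^sub>v x"
  have z: "z \<in> carrier_vec n" using A x by (auto simp: psd_mat_def z_def intro: mult_mat_vec_carrier)
  have "(z \<bullet> z)\<^sup>2 \<le> (z \<bullet> (A *\<^sub>v z)) * (x \<bullet> (A *\<^sub>v x))"
    using psd_mat_Cauchy_Schwarz[OF A z x] by (simp add: z_def)
  \<comment> \<open>The nonnegativity that \<open>mult_mono\<close> asks of
    \<open>\<mu> * (z \<bullet> z)\<close> comes by transitivity through
    \<open>z \<bullet> A z\<close>.\<close>
  also have "\<dots> \<le> (\<mu> * (z \<bullet> z)) * (\<mu> * (x \<bullet> x))"
    using A x z le by (intro mult_mono) (auto simp: psd_mat_def intro: order_trans)
  finally have "(z \<bullet> z) * (z \<bullet> z) \<le> (z \<bullet> z) * (\<mu>\<^sup>2 * (x \<bullet> x))"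
    by (simp add: power2_eq_square algebra_simps)
  then show ?thesis
    using real_scalar_prod_self_nonneg[of z] real_scalar_prod_self_nonneg[of x]
    by (cases "z \<bullet> z = 0") (simp_all add: z_def[symmetric])
qed

lemma psd_mat_pow_norm_le:
  assumes A: "psd_mat n A"
    and le: "\<And>x. x \<in> carrier_vec n \<Longrightarrow> x \<bullet> (A *\<^sub>v x) \<le> \<mu> * (x \<bullet> x)"
    and x: "x \<in> carrier_vec n"
  shows "(A ^\<^sub>m k *\<^sub>v x) \<bullet> (A ^\<^sub>m k *\<^sub>v x) \<le> (\<mu> ^ k)\<^sup>2 * (x \<bullet> x)"
  using x
proof (induction k arbitrary: x)
  case 0
  then show ?case using A by (auto simp: psd_mat_def)
next
  case (Suc k)
  have A': "A \<in> carrier_mat n n" using A by (simp add: psd_mat_def)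
  then have Ax: "A *\<^sub>v x \<in> carrier_vec n"
    using Suc.prems by (rule mult_mat_vec_carrier)
  \<comment> \<open>The innermost factor is peeled off, so the induction hypothesis is used at
    \<open>A x\<close>; hence \<open>x\<close> is kept arbitrary.\<close>
  have "A ^\<^sub>m Suc k *\<^sub>v x = A ^\<^sub>m k *\<^sub>v (A *\<^sub>v x)"
    using A' Suc.prems by (simp add: assoc_mult_mat_vec[of _ n n _ n])
  then have "(A ^\<^sub>m Suc k *\<^sub>v x) \<bullet> (A ^\<^sub>m Suc k *\<^sub>v x) \<le> (\<mu> ^ k)\<^sup>2 * ((A *\<^sub>v x) \<bullet> (A *\<^sub>v x))"
    using Suc.IH[OF Ax] by simp
  also have "\<dots> \<le> (\<mu> ^ k)\<^sup>2 * (\<mu>\<^sup>2 * (x \<bullet> x))"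
    using psd_mat_norm_le[OF A le Suc.prems] by (intro mult_left_mono) auto
  finally show ?case by (simp add: power_mult_distrib algebra_simps)
qed

text \<open>Ordinary Cauchy-Schwarz for \<open>x\<close> and \<open>A^k x\<close> reduces the claim
  to the norm bound; \<open>\<mu> \<ge> 0\<close> allows the squares to be removed at the
  end.\<close>

lemma psd_mat_pow_quadratic_form_le:
  assumes A: "psd_mat n A" and \<mu>: "\<mu> \<ge> 0"
    and le: "\<And>x. x \<in> carrier_vec n \<Longrightarrow> x \<bullet> (A *\<^sub>v x) \<le> \<mu> * (x \<bullet> x)"
    and x: "x \<in> carrier_vec n"
  shows "x \<bullet> (A ^\<^sub>m k *\<^sub>v x) \<le> \<mu> ^ k * (x \<bullet> x)"
proof -
  define z where "z = A ^\<^sub>m k *\<^sub>v x"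
  have z: "z \<in> carrier_vec n"
    unfolding z_def using A x
    by (intro mult_mat_vec_carrier pow_carrier_mat) (auto simp: psd_mat_def)
  have "(x \<bullet> z)\<^sup>2 \<le> (x \<bullet> x) * (z \<bullet> z)"
    using psd_mat_Cauchy_Schwarz[OF psd_mat_one x z] x z by simp
  also have "\<dots> \<le> (x \<bullet> x) * ((\<mu> ^ k)\<^sup>2 * (x \<bullet> x))"
    unfolding z_def using psd_mat_pow_norm_le[OF A le x]
    by (intro mult_left_mono real_scalar_prod_self_nonneg) auto
  finally have "(x \<bullet> z)\<^sup>2 \<le> (\<mu> ^ k * (x \<bullet> x))\<^sup>2"
    by (simp add: power2_eq_square algebra_simps)
  moreover have "0 \<le> \<mu> ^ k * (x \<bullet> x)"
    using \<mu> real_scalar_prod_self_nonneg[of x] by simp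
  ultimately show ?thesis
    unfolding z_def by (rule power2_le_imp_le)
qed

lemma transpose_pow_mat_symmetric:
  fixes A :: "real mat"
  assumes A: "A \<in> carrier_mat n n" "transpose_mat A = A"
  shows "transpose_mat (A ^\<^sub>m k) = A ^\<^sub>m k"
proof (induction k)
  case (Suc k)
  \<comment> \<open>Transposition reverses \<open>A^k A\<close> into \<open>A A^k\<close>, whereas
    the recursion for powers multiplies on the right.\<close>
  have comm: "A * A ^\<^sub>m j = A ^\<^sub>m j * A" for j
  proof (induction j)
    case (Suc j)
    have "A * A ^\<^sub>m Suc j = (A * A ^\<^sub>m j) * A"
      using A by (simp add: assoc_mult_mat[of _ n n _ n _ n])
    then show ?case by (simp add: Suc.IH)
  qed (use A in simp)
  have "transpose_mat (A ^\<^sub>m Suc k) = A * A ^\<^sub>m k"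
    using A Suc.IH by (simp add: transpose_mult[of _ n n _ n])
  then show ?case by (simp add: comm)
qed simp

section \<open>The Laplacian matrix\<close>

lemma laplacian_carrier [simp]:
  "laplacian_mat G vs \<in> carrier_mat (length vs) (length vs)"
  by (auto simp: laplacian_mat_def degree_mat_def adjacency_mat_def)

context
  fixes G :: "('a, 'b) pre_digraph" and vs :: "'a list"
  assumes graph: "graph G" and vs: "enumerates_verts G vs"
begin

interpretation graph G by (rule graph)

private definition adj :: "nat \<Rightarrow> nat \<Rightarrow> real" where
  "adj i j = (if vs ! i \<rightarrow>\<^bsub>G\<^esub> vs ! j then 1 else 0)"

text \<open>The out-degree counts arcs and the sum counts neighbours. Without parallel arcs the head
  map is injective on the arcs leaving a vertex, so the counts agree.\<close>

lemma out_degree_eq_sum_adj: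
  "real (out_degree G (vs ! i)) = (\<Sum>j<length vs. adj i j)"
proof -
  have vs': "distinct vs" "set vs = verts G" using vs by (auto simp: enumerates_verts_def)
  let ?J = "{j. j < length vs \<and> vs ! i \<rightarrow>\<^bsub>G\<^esub> vs ! j}"
  have inj_head: "inj_on (head G) (out_arcs G (vs ! i))"
    by (auto intro!: inj_onI no_multi_arcs simp: arc_to_ends_def)
  have image: "head G ` out_arcs G (vs ! i) = (!) vs ` ?J"
  proof (intro equalityI subsetI)
    fix w assume "w \<in> head G ` out_arcs G (vs ! i)"
    then obtain e where e: "e \<in> arcs G" "tail G e = vs ! i" "w = head G e" by auto
    then have "w \<in> set vs" using vs' by simp
    then obtain j where "j < length vs" "w = vs ! j" by (auto simp: in_set_conv_nth)
    then show "w \<in> (!) vs ` ?J"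
      using e by (metis (mono_tags, lifting) image_eqI in_arcs_imp_in_arcs_ends mem_Collect_eq)
  next
    fix w assume "w \<in> (!) vs ` ?J"
    then show "w \<in> head G ` out_arcs G (vs ! i)"
      by (force simp: arcs_ends_conv)
  qed
  have inj_nth: "inj_on ((!) vs) ?J"
    using vs' by (auto intro!: inj_onI simp: nth_eq_iff_index_eq)
  have "out_degree G (vs ! i) = card ?J"
    unfolding out_degree_def card_image[OF inj_head, symmetric] image
    by (rule card_image[OF inj_nth])
  also have "real \<dots> = (\<Sum>j<length vs. adj i j)"
    by (simp add: adj_def sum.If_cases Int_def)
  finally show ?thesis .
qed

lemma adj_sym: "adj i j = adj j i"
  unfolding adj_def using sym_arcs by (auto simp: symmetric_def dest: symD)

lemma laplacian_index:
  assumes "i < length vs" "j < length vs"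
  shows "laplacian_mat G vs $$ (i, j) =
    (if i = j then \<Sum>l<length vs. adj i l else 0) - adj i j"
  using assms
  by (simp add: laplacian_mat_def degree_mat_def adjacency_mat_def out_degree_eq_sum_adj)
     (simp add: adj_def)

text \<open>Written with differences, the action shows at once that constant vectors are
  annihilated, and it leads to the sum of squares behind semidefiniteness.\<close>

lemma laplacian_mult_vec_index:
  assumes "i < length vs" "x \<in> carrier_vec (length vs)"
  shows "(laplacian_mat G vs *\<^sub>v x) $ i = (\<Sum>j<length vs. adj i j * (x $ i - x $ j))"
proof -
  have "(laplacian_mat G vs *\<^sub>v x) $ i = (\<Sum>j<length vs. laplacian_mat G vs $$ (i, j) * x $ j)"
    using assms carrier_matD[OF laplacian_carrier[of G vs]]
    by (simp add: scalar_prod_def lessThan_atLeast0)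
  also have "\<dots> = (\<Sum>j<length vs. (if i = j then (\<Sum>l<length vs. adj i l) * x $ j else 0) - adj i j * x $ j)"
    using assms by (intro sum.cong) (auto simp: laplacian_index algebra_simps)
  also have "\<dots> = (\<Sum>j<length vs. adj i j * (x $ i - x $ j))"
    using assms by (simp add: sum_subtractf sum_distrib_right right_diff_distrib)
  finally show ?thesis .
qed

lemma laplacian_transpose: "transpose_mat (laplacian_mat G vs) = laplacian_mat G vs"
  using carrier_matD[OF laplacian_carrier[of G vs]]
  by (intro eq_matI) (auto simp: laplacian_index adj_sym)

lemma laplacian_mult_ones:
  "laplacian_mat G vs *\<^sub>v vec (length vs) (\<lambda>_. 1) = 0\<^sub>v (length vs)"
proof (rule eq_vecI)
  fix i assume "i < dim_vec (0\<^sub>v (length vs) :: real vec)"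
  then have i: "i < length vs" by simp
  then show "(laplacian_mat G vs *\<^sub>v vec (length vs) (\<lambda>_. 1)) $ i = 0\<^sub>v (length vs) $ i"
    by (subst laplacian_mult_vec_index) auto
qed (use carrier_matD[OF laplacian_carrier[of G vs]] in simp)

text \<open>Twice the form is the sum of \<open>(x $ i - x $ j)\<^sup>2\<close> over ordered
  adjacent pairs, obtained by averaging the difference formula with its copy under exchange of
  \<open>i\<close> and \<open>j\<close>.\<close>

lemma laplacian_psd: "psd_mat (length vs) (laplacian_mat G vs)"
  unfolding psd_mat_def
proof (intro conjI ballI laplacian_transpose)
  fix x :: "real vec" assume x: "x \<in> carrier_vec (length vs)"
  let ?N = "{..<length vs}" and ?L = "laplacian_mat G vs"
  have form: "x \<bullet> (?L *\<^sub>v x) = (\<Sum>i\<in>?N. \<Sum>j\<in>?N. adj i j * (x $ i * (x $ i - x $ j)))"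
    using x carrier_matD[OF laplacian_carrier[of G vs]]
    by (simp add: scalar_prod_def lessThan_atLeast0 laplacian_mult_vec_index
        del: index_mult_mat_vec)
       (simp add: sum_distrib_left algebra_simps)
  also have "\<dots> = (\<Sum>i\<in>?N. \<Sum>j\<in>?N. adj i j * (x $ j * (x $ j - x $ i)))"
    by (subst sum.swap) (simp add: adj_sym)
  finally have "2 * (x \<bullet> (?L *\<^sub>v x)) =
      (\<Sum>i\<in>?N. \<Sum>j\<in>?N. adj i j * (x $ i * (x $ i - x $ j)) + adj i j * (x $ j * (x $ j - x $ i)))"
    unfolding sum.distrib using form by linarith
  also have "\<dots> = (\<Sum>i\<in>?N. \<Sum>j\<in>?N. adj i j * (x $ i - x $ j)\<^sup>2)"
    by (intro sum.cong refl) (simp add: power2_eq_square algebra_simps)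
  also have "\<dots> \<ge> 0"
    by (intro sum_nonneg) (auto simp: adj_def)
  finally show "0 \<le> x \<bullet> (?L *\<^sub>v x)" by simp
qed simp

section \<open>Powers of the Laplacian: distances and the all-ones vector\<close>

text \<open>A nonzero entry of the power needs a nonzero product of \<open>k\<close> entries of the
  Laplacian; each factor either stays at a vertex (diagonal) or crosses an edge.\<close>

lemma laplacian_pow_nonzero_imp_walk:
  assumes "i < length vs" "j < length vs" "(laplacian_mat G vs ^\<^sub>m k) $$ (i, j) \<noteq> 0"
  shows "\<exists>p. awalk (vs ! i) p (vs ! j) \<and> length p \<le> k"
  using assms
proof (induction k arbitrary: j)
  case 0
  have "dim_row (laplacian_mat G vs) = length vs"
    by (rule carrier_matD[OF laplacian_carrier])
  with 0 have "i = j"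
    by (simp split: if_splits)
  have "vs ! i \<in> verts G"
    using vs 0(1) nth_mem[of i vs] by (simp add: enumerates_verts_def)
  then have "awalk (vs ! i) [] (vs ! j)"
    by (simp add: \<open>i = j\<close> awalk_Nil_iff)
  then show ?case by (intro exI[of _ "[]"]) simp
next
  case (Suc k)
  let ?L = "laplacian_mat G vs"
  have "(?L ^\<^sub>m Suc k) $$ (i, j) = (\<Sum>l<length vs. (?L ^\<^sub>m k) $$ (i, l) * ?L $$ (l, j))"
    using Suc.prems carrier_matD[OF laplacian_carrier[of G vs]]
    by (simp add: scalar_prod_def lessThan_atLeast0)
  with Suc.prems obtain l where l: "l < length vs" "(?L ^\<^sub>m k) $$ (i, l) \<noteq> 0" "?L $$ (l, j) \<noteq> 0"
    by (metis (no_types, lifting) lessThan_iff mult_eq_0_iff sum.neutral)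
  then obtain p where p: "awalk (vs ! i) p (vs ! l)" "length p \<le> k"
    using Suc.IH Suc.prems by blast
  show ?case
  proof (cases "l = j")
    \<comment> \<open>A diagonal factor does not lengthen the walk, which is why the length is at
      most \<open>k\<close> and not exactly \<open>k\<close>.\<close>
    case True
    then show ?thesis using p le_SucI by blast
  next
    case False
    then have "vs ! l \<rightarrow>\<^bsub>G\<^esub> vs ! j"
      using l Suc.prems by (auto simp: laplacian_index adj_def split: if_splits)
    then obtain e where "e \<in> arcs G" "tail G e = vs ! l" "head G e = vs ! j"
      by (auto simp: arcs_ends_conv)
    then have "awalk (vs ! l) [e] (vs ! j)"
      using head_in_verts[of e] by (simp add: awalk_Cons_iff awalk_Nil_iff)
    with p(1) have "awalk (vs ! i) (p @ [e]) (vs ! j)" by (rule awalk_appendI)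
    with p(2) show ?thesis by (intro exI[of _ "p @ [e]"]) simp
  qed
qed

text \<open>With unit costs the cost of a walk is its length, so the walk given by a nonzero entry
  would bound the distance by \<open>k\<close>.\<close>

lemma laplacian_pow_eq_0_if_dist:
  assumes "i < length vs" "j < length vs" "graph_dist G (vs ! i) (vs ! j) > ereal (real k)"
  shows "(laplacian_mat G vs ^\<^sub>m k) $$ (i, j) = 0"
proof (rule ccontr)
  assume "\<not> ?thesis"
  then obtain p where p: "awalk (vs ! i) p (vs ! j)" "length p \<le> k"
    using laplacian_pow_nonzero_imp_walk assms by blast
  have "awalk_cost (\<lambda>_. 1) p = real (length p)"
    by (simp add: awalk_cost_def sum_list_triv)
  then have "graph_dist G (vs ! i) (vs ! j) \<le> ereal (real (length p))"
    using min_cost_le_walk_cost[OF p(1), of "\<lambda>_. 1"] by (simp add: graph_dist_def)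
  also have "\<dots> \<le> ereal (real k)" using p(2) by simp
  finally show False using assms(3) by simp
qed

end

lemma laplacian_pow_mult_ones:
  assumes "graph G" "enumerates_verts G vs" "k > 0"
  shows "laplacian_mat G vs ^\<^sub>m k *\<^sub>v vec (length vs) (\<lambda>_. 1) = 0\<^sub>v (length vs)"
proof -
  \<comment> \<open>Positivity of \<open>k\<close> supplies the factor that meets the all-ones
    vector first; the zeroth power would be the identity.\<close>
  obtain j where k: "k = Suc j" using assms(3) by (cases k) auto
  have "laplacian_mat G vs ^\<^sub>m k *\<^sub>v vec (length vs) (\<lambda>_. 1) =
      laplacian_mat G vs ^\<^sub>m j *\<^sub>v (laplacian_mat G vs *\<^sub>v vec (length vs) (\<lambda>_. 1))"
    unfolding k pow_mat.simps
    by (rule assoc_mult_mat_vec[of _ "length vs" "length vs" _ "length vs"]) auto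
  moreover have "laplacian_mat G vs ^\<^sub>m j *\<^sub>v 0\<^sub>v (length vs) = 0\<^sub>v (length vs)"
    using carrier_matD(1)[OF laplacian_carrier[of G vs]]
      pow_carrier_mat[OF laplacian_carrier[of G vs], of j]
    by (intro eq_vecI) (simp_all add: scalar_prod_right_zero[OF row_carrier_vec])
  ultimately show ?thesis
    by (simp add: laplacian_mult_ones[OF assms(1,2)])
qed

section \<open>The bound for independent sets\<close>

theorem theorem13:
  fixes G :: "('a, 'b) pre_digraph" and vs :: "'a list" and S :: "'a set"
    and k n :: nat and \<mu> :: real
  assumes "k > 0"
    and "graph G"
    and "enumerates_verts G vs"
    and "n = card (verts G)"
    and "largest_eigenvalue (laplacian_mat G vs) \<mu>"
    and "\<mu> > 0"
    and "k_independent G k S"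
    and "S \<noteq> {}"
  shows "real (card S) \<le> real n * (\<mu> ^ k - avg_diag_laplacian_pow G vs k S) / \<mu> ^ k"
proof -
  have vs: "distinct vs" "set vs = verts G"
    using assms(3) by (auto simp: enumerates_verts_def)
  have n: "length vs = n"
    using assms(4) vs distinct_card by fastforce
  define s where "s = real (card S)"
  let ?d = "avg_diag_laplacian_pow G vs k S"
  let ?I = "{i. i < length vs \<and> vs ! i \<in> S}"
  define P where "P = laplacian_mat G vs ^\<^sub>m k"
  define x :: "real vec" where "x = vec n (\<lambda>i. if vs ! i \<in> S then 1 else 0)"
  define e :: "real vec" where "e = vec n (\<lambda>_. 1)"
  have S: "S \<subseteq> verts G" using assms(7) by (simp add: k_independent_def)
  then have "finite S" using vs by (metis List.finite_set finite_subset)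
  then have "card S > 0" using assms(8) by (simp add: card_gt_0_iff)
  then have spos: "s > 0" by (simp add: s_def)
  have "card S \<le> n"
    using S vs n by (metis List.finite_set card_mono distinct_card)
  with \<open>card S > 0\<close> have npos: "n > 0" by simp
  have inj: "inj_on ((!) vs) ?I"
    using vs by (auto intro!: inj_onI simp: nth_eq_iff_index_eq)
  have "(!) vs ` ?I = S \<inter> set vs"
    unfolding set_conv_nth by blast
  \<comment> \<open>Passes from vertices to their positions in \<open>vs\<close>, over which all the
    sums run.\<close>
  then have cardI: "card ?I = card S"
    using card_image[OF inj] S vs(2) by (simp add: Int_absorb2)
  have x: "x \<in> carrier_vec n" and e: "e \<in> carrier_vec n"
    by (simp_all add: x_def e_def)
  have L: "laplacian_mat G vs \<in> carrier_mat n n"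
    using laplacian_carrier[of G vs] n by simp
  have P: "P \<in> carrier_mat n n"
    using pow_carrier_mat[OF L] by (simp add: P_def)
  have PT: "transpose_mat P = P"
    unfolding P_def by (rule transpose_pow_mat_symmetric[OF L laplacian_transpose[OF assms(2,3)]])
  have Pe: "P *\<^sub>v e = 0\<^sub>v n"
    using laplacian_pow_mult_ones[OF assms(2,3,1)] n by (simp add: P_def e_def)

  have s_sum: "s = (\<Sum>i = 0..<n. if vs ! i \<in> S then 1 else 0)"
    using cardI n by (simp add: s_def sum.If_cases Int_def)
  have xx: "x \<bullet> x = s"
    unfolding s_sum by (simp add: x_def scalar_prod_def) (intro sum.cong; simp)
  have xe: "x \<bullet> e = s"
    unfolding s_sum by (simp add: x_def e_def scalar_prod_def)
  have ee: "e \<bullet> e = real n"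
    by (simp add: e_def scalar_prod_def)

  have off: "P $$ (i, j) = 0"
    if ij: "i < n" "j < n" "vs ! i \<in> S" "vs ! j \<in> S" "i \<noteq> j" for i j
  proof -
    have "vs ! i \<noteq> vs ! j"
      using ij vs(1) n by (simp add: nth_eq_iff_index_eq)
    then have "graph_dist G (vs ! i) (vs ! j) > ereal (real k)"
      using assms(7) ij unfolding k_independent_def by blast
    then show ?thesis
      unfolding P_def using ij n by (intro laplacian_pow_eq_0_if_dist[OF assms(2,3)]) simp_all
  qed
  have "x \<bullet> (P *\<^sub>v x) = (\<Sum>i | i < n \<and> vs ! i \<in> S. P $$ (i, i))"
    unfolding x_def by (rule indicator_quadratic_form[OF P off])
  also have "\<dots> = s * ?d"
    using spos unfolding avg_diag_laplacian_pow_def P_def s_def n by simp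
  finally have xPx: "x \<bullet> (P *\<^sub>v x) = s * ?d" .

  \<comment> \<open>The coefficient is \<open>- (x \<bullet> e) / (e \<bullet> e)\<close>, which
    makes \<open>y\<close> orthogonal to \<open>e\<close>; the factor 1 matches the shape of
    \<open>quadratic_form_add_smult\<close>.\<close>
  define y where "y = 1 \<cdot>\<^sub>v x + (- s / n) \<cdot>\<^sub>v e"
  have y: "y \<in> carrier_vec n" using x e by (simp add: y_def)
  \<comment> \<open>The mixed term and the \<open>e\<close> term vanish because \<open>P\<close>
    annihilates \<open>e\<close>.\<close>
  have "y \<bullet> (P *\<^sub>v y) = s * ?d"
    unfolding y_def quadratic_form_add_smult[OF P PT x e] using x e Pe xPx by simp
  \<comment> \<open>The same expansion with the identity matrix gives
    \<open>s - 2 s\<^sup>2 / n + s\<^sup>2 / n\<close>.\<close>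
  moreover have "y \<bullet> y = s - s\<^sup>2 / n"
    using quadratic_form_add_smult[of "1\<^sub>m n" n x e 1 "- s / n", folded y_def]
      x e y xx xe ee npos
    by (simp add: power2_eq_square)
  moreover have "y \<bullet> (P *\<^sub>v y) \<le> \<mu> ^ k * (y \<bullet> y)"
    unfolding P_def
  proof (rule psd_mat_pow_quadratic_form_le[OF _ _ _ y])
    show "psd_mat n (laplacian_mat G vs)"
      using laplacian_psd[OF assms(2,3)] n by simp
    show "z \<bullet> (laplacian_mat G vs *\<^sub>v z) \<le> \<mu> * (z \<bullet> z)" if "z \<in> carrier_vec n" for z
      by (rule largest_eigenvalue_quadratic_form_le[OF L laplacian_transpose[OF assms(2,3)] assms(5) that])
  qed (use assms(6) in simp)
  ultimately have "s * ?d \<le> \<mu> ^ k * (s - s\<^sup>2 / n)"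
    by simp
  also have "\<dots> = s * (\<mu> ^ k * (1 - s / n))"
    by (simp add: power2_eq_square algebra_simps)
  finally have "s * ?d \<le> s * (\<mu> ^ k * (1 - s / n))" .
  then have "?d \<le> \<mu> ^ k * (1 - s / n)"
    using spos by simp
  then have "\<mu> ^ k * s \<le> n * (\<mu> ^ k - ?d)"
    using npos by (simp add: field_simps)
  then show ?thesis
    using assms(6) by (simp add: s_def field_simps)
qed

end
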